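(* For all integers $m\geq 3$ and $v\geq 3$, $$OCAN(3,m,3,v)\ \leq\ OCAN(3,m,2,v-1)+m\cdot CAN(2,m-1,v-1)+CAN(2,m,v-1)+m(v-1)^2+1.$$
   Context: Covering: given an $N\times n$ array over an alphabet $V$ of size $v$, a set of $t$ columns is covered if every $t$-tuple over $V$ occurs at least once as a row of the $N\times t$ subarray formed by those columns. Covering array: for $2\le t\le n$, a $CA(N;t,n,v)$ is an $N\times n$ array with entries from an alphabet of size $v$ such that every set of $t$ columns is covered; $CAN(t,n,v)$ is the smallest positive integer $N$ for which a $CA(N;t,n,v)$ exists. NRT poset: for positive integers $m,s$, the NRT poset $[m\cdot s]$ is the set $\{1,\ldots,ms\}$ partitioned into $m$ blocks $B_i=\{is+1,\ldots,(i+1)s\}$, $i=0,\ldots,m-1$, where each block is a chain $is+1\preceq is+2\preceq\cdots\preceq (i+1)s$ and elements of different blocks are incomparable. An ideal is a subset $I$ such that $b\in I$ and $a\preceq b$ imply $a\in I$; an anti-ideal is the complement of an ideal. Ordered covering array: for $2\le t\le ms$, an $OCA(N;t,m,s,v)$ is an $N\times ms$ array with entries from an alphabet of size $v$, with columns labeled by $[m\cdot s]$, such that for every anti-ideal $J$ of $[m\cdot s]$ with $|J|=t$ the set of columns labeled by $J$ is covered. $OCAN(t,m,s,v)$ is the smallest positive integer $N$ such that an $OCA(N;t,m,s,v)$ exists. *)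

theory Defs
  imports Main "HOL-Library.FuncSet"
begin

text \<open>An array with \<open>N\<close> rows is a function \<open>A :: nat \<Rightarrow> nat \<Rightarrow> 'a\<close>; only the entries
  \<open>A r c\<close> with row \<open>r < N\<close> and column \<open>c \<in> {1..n}\<close> matter. Tuples over \<open>V\<close> indexed by a set
  \<open>T\<close> of columns are the extensional functions in \<open>T \<rightarrow>\<^sub>E V\<close>.\<close>

definition is_array :: "nat \<Rightarrow> nat \<Rightarrow> 'a set \<Rightarrow> (nat \<Rightarrow> nat \<Rightarrow> 'a) \<Rightarrow> bool" where
  "is_array N n V A \<longleftrightarrow> (\<forall>r<N. \<forall>c\<in>{1..n}. A r c \<in> V)"

definition covered :: "nat \<Rightarrow> 'a set \<Rightarrow> (nat \<Rightarrow> nat \<Rightarrow> 'a) \<Rightarrow> nat set \<Rightarrow> bool" where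
  "covered N V A T \<longleftrightarrow> (\<forall>x \<in> T \<rightarrow>\<^sub>E V. \<exists>r<N. restrict (A r) T = x)"

definition covering_array ::
    "nat \<Rightarrow> nat \<Rightarrow> nat \<Rightarrow> nat \<Rightarrow> 'a set \<Rightarrow> (nat \<Rightarrow> nat \<Rightarrow> 'a) \<Rightarrow> bool" where
  "covering_array N t n v V A \<longleftrightarrow>
     2 \<le> t \<and> t \<le> n \<and> finite V \<and> card V = v \<and> is_array N n V A \<and>
     (\<forall>T. T \<subseteq> {1..n} \<and> card T = t \<longrightarrow> covered N V A T)"

text \<open>Only the size of the alphabet matters, so alphabets consisting of natural numbers
  suffice for the existence of arrays.\<close>

definition CAN :: "nat \<Rightarrow> nat \<Rightarrow> nat \<Rightarrow> nat" where
  "CAN t n v = (LEAST N. 0 < N \<and> (\<exists>(V :: nat set) A. covering_array N t n v V A))"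

definition nrt_block :: "nat \<Rightarrow> nat \<Rightarrow> nat set" where
  "nrt_block s i = {i * s + 1..(i + 1) * s}"

definition nrt_le :: "nat \<Rightarrow> nat \<Rightarrow> nat \<Rightarrow> nat \<Rightarrow> bool" where
  "nrt_le m s a b \<longleftrightarrow> (\<exists>i<m. a \<in> nrt_block s i \<and> b \<in> nrt_block s i \<and> a \<le> b)"

definition nrt_ideal :: "nat \<Rightarrow> nat \<Rightarrow> nat set \<Rightarrow> bool" where
  "nrt_ideal m s I \<longleftrightarrow> I \<subseteq> {1..m * s} \<and> (\<forall>b\<in>I. \<forall>a. nrt_le m s a b \<longrightarrow> a \<in> I)"

definition nrt_anti_ideal :: "nat \<Rightarrow> nat \<Rightarrow> nat set \<Rightarrow> bool" where
  "nrt_anti_ideal m s J \<longleftrightarrow> (\<exists>I. nrt_ideal m s I \<and> J = {1..m * s} - I)"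

definition ordered_covering_array ::
    "nat \<Rightarrow> nat \<Rightarrow> nat \<Rightarrow> nat \<Rightarrow> nat \<Rightarrow> 'a set \<Rightarrow> (nat \<Rightarrow> nat \<Rightarrow> 'a) \<Rightarrow> bool" where
  "ordered_covering_array N t m s v V A \<longleftrightarrow>
     2 \<le> t \<and> t \<le> m * s \<and> finite V \<and> card V = v \<and> is_array N (m * s) V A \<and>
     (\<forall>J. nrt_anti_ideal m s J \<and> card J = t \<longrightarrow> covered N V A J)"

definition OCAN :: "nat \<Rightarrow> nat \<Rightarrow> nat \<Rightarrow> nat \<Rightarrow> nat" where
  "OCAN t m s v =
     (LEAST N. 0 < N \<and> (\<exists>(V :: nat set) A. ordered_covering_array N t m s v V A))"

end

theory Submission
  imports Defs
begin

text \<open>Adjoin a new symbol \<open>\<infinity>\<close>, encoded as \<open>w\<close>, to an alphabet \<open>{..<w}\<close> with \<open>w = v - 1\<close>. In each block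
  of \<open>[m \<cdot> 3]\<close> call the columns bot, mid and top. Five kinds of rows are stacked:
  an ordered covering array on \<open>[m \<cdot> 2]\<close> occupying the mid and top columns; for each block \<open>k\<close>, the
  rows with \<open>\<infinity>\<close> in the top of \<open>k\<close>, a covering array of strength 2 in the other tops and \<open>\<infinity>\<close> in all
  mids; a covering array of strength 2 in all tops with \<open>\<infinity>\<close> in all mids; for each block \<open>k\<close> and
  symbols \<open>x\<close>, \<open>a\<close> of the small alphabet, the row with \<open>a\<close> in the top of \<open>k\<close>, \<open>\<infinity>\<close> in the other tops
  and \<open>x\<close> in all mids; and the row constantly \<open>\<infinity>\<close>. These cover the anti-ideals that contain no bot
  column. Moreover every (mid, top) pair of a block occurs in at least \<open>w + 1\<close> rows, so that the bot
  columns can be filled in to cover each whole block.\<close>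

section \<open>Coverage and existence of arrays\<close>

text \<open>Only the values on \<open>T\<close> matter, so extensional tuples give way to arbitrary
  functions; later coverage arguments use this form.\<close>

lemma covered_iff:
  "covered N V A T \<longleftrightarrow> (\<forall>x. (\<forall>c\<in>T. x c \<in> V) \<longrightarrow> (\<exists>r<N. \<forall>c\<in>T. A r c = x c))"
proof
  assume L: "covered N V A T"
  show "\<forall>x. (\<forall>c\<in>T. x c \<in> V) \<longrightarrow> (\<exists>r<N. \<forall>c\<in>T. A r c = x c)"
  proof (intro allI impI)
    fix x assume "\<forall>c\<in>T. x c \<in> V"
    then have "restrict x T \<in> T \<rightarrow>\<^sub>E V" by auto
    then obtain r where "r < N" "restrict (A r) T = restrict x T"
      using L unfolding covered_def by blast
    then show "\<exists>r<N. \<forall>c\<in>T. A r c = x c" by (metis restrict_apply')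
  qed
next
  assume R: "\<forall>x. (\<forall>c\<in>T. x c \<in> V) \<longrightarrow> (\<exists>r<N. \<forall>c\<in>T. A r c = x c)"
  show "covered N V A T"
    unfolding covered_def
  proof
    fix x assume x: "x \<in> T \<rightarrow>\<^sub>E V"
    then have "\<forall>c\<in>T. x c \<in> V" by (blast intro: PiE_mem)
    then obtain r where r: "r < N" "\<forall>c\<in>T. A r c = x c" using R by blast
    have "restrict (A r) T = x"
    proof
      fix c show "restrict (A r) T c = x c"
        using r(2) PiE_arb[OF x, of c] by (cases "c \<in> T") auto
    qed
    with r(1) show "\<exists>r<N. restrict (A r) T = x" by blast
  qed
qed

lemma covered_bij_betw:
  assumes "bij_betw f V W" "covered N V A T"
  shows "covered N W (\<lambda>r c. f (A r c)) T"
  unfolding covered_iff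
proof (intro allI impI)
  fix x assume x: "\<forall>c\<in>T. x c \<in> W"
  define y where "y = (\<lambda>c. inv_into V f (x c))"
  have y: "y c \<in> V" "f (y c) = x c" if "c \<in> T" for c
    using x that assms(1) unfolding y_def bij_betw_def
    by (metis inv_into_into, metis f_inv_into_f)
  then obtain r where "r < N" "\<forall>c\<in>T. A r c = y c"
    using assms(2) unfolding covered_iff by blast
  then show "\<exists>r<N. \<forall>c\<in>T. f (A r c) = x c" using y by auto
qed

lemma is_array_bij_betw:
  "bij_betw f V W \<Longrightarrow> is_array N n V A \<Longrightarrow> is_array N n W (\<lambda>r c. f (A r c))"
  unfolding is_array_def by (auto dest: bij_betwE)

text \<open>Shows that the minima defining \<open>CAN\<close> and \<open>OCAN\<close> range over
  nonempty sets: listing all tuples as rows covers every set of columns.\<close>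

lemma exists_array_of_all_rows:
  assumes "finite V" "V \<noteq> {}"
  shows "\<exists>N A. 0 < N \<and> is_array N n V A \<and> (\<forall>T \<subseteq> {1..n}. covered N V A T)"
proof -
  let ?P = "{1..n} \<rightarrow>\<^sub>E V"
  have fin: "finite ?P" and ne: "?P \<noteq> {}"
    using assms by (auto intro: finite_PiE simp: PiE_eq_empty_iff)
  obtain A where A: "bij_betw A {0..<card ?P} ?P"
    using ex_bij_betw_nat_finite[OF fin] by blast
  have "0 < card ?P" using fin ne by (simp add: card_gt_0_iff)
  moreover have "is_array (card ?P) n V A"
    unfolding is_array_def
  proof (intro allI impI ballI)
    fix r c assume "r < card ?P" "c \<in> {1..n}"
    then have "A r \<in> ?P" using bij_betwE[OF A] by simp
    then show "A r c \<in> V" using \<open>c \<in> {1..n}\<close> by (rule PiE_mem)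
  qed
  moreover have "covered (card ?P) V A T" if "T \<subseteq> {1..n}" for T
    unfolding covered_iff
  proof (intro allI impI)
    fix x assume x: "\<forall>c\<in>T. x c \<in> V"
    \<comment> \<open>\<open>u\<close> pads the columns outside \<open>T\<close>, which extends the
      tuple to a full row.\<close>
    obtain u where "u \<in> V" using assms by auto
    define y where "y = restrict (\<lambda>c. if c \<in> T then x c else u) {1..n}"
    have "y \<in> ?P" using x \<open>u \<in> V\<close> by (auto simp: y_def)
    then have "y \<in> A ` {0..<card ?P}" by (simp only: bij_betw_imp_surj_on[OF A])
    then obtain r where "r < card ?P" "A r = y" by auto
    moreover have "y c = x c" if "c \<in> T" for c
      using that \<open>T \<subseteq> {1..n}\<close> by (auto simp: y_def)
    ultimately show "\<exists>r<card ?P. \<forall>c\<in>T. A r c = x c" by blast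
  qed
  ultimately show ?thesis by (intro exI[of _ "card ?P"] exI[of _ A] conjI allI impI)
qed

text \<open>A least array exists over some alphabet; a bijection renames that alphabet to
  \<open>{..<v}\<close>, leaving the number \<open>v\<close> free as a new symbol.\<close>

lemma CAN_attained:
  assumes "2 \<le> t" "t \<le> n" "0 < v"
  obtains A where "covering_array (CAN t n v) t n v {..<v} A"
proof -
  obtain N A where "0 < N" "is_array N n {..<v} A" "\<forall>T \<subseteq> {1..n}. covered N {..<v} A T"
    using exists_array_of_all_rows[of "{..<v}" n] assms(3)
    by (metis finite_lessThan lessThan_empty_iff neq0_conv)
  then have "covering_array N t n v {..<v} A"
    using assms by (simp add: covering_array_def)
  with \<open>0 < N\<close> have "\<exists>N. 0 < N \<and> (\<exists>(V :: nat set) A. covering_array N t n v V A)" by blast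
  from LeastI_ex[OF this] obtain V :: "nat set" and A
    where A: "covering_array (CAN t n v) t n v V A" unfolding CAN_def by blast
  then obtain f where f: "bij_betw f V {..<v}"
    by (metis card_lessThan covering_array_def finite_lessThan finite_same_card_bij)
  have "covering_array (CAN t n v) t n v {..<v} (\<lambda>r c. f (A r c))"
    using A unfolding covering_array_def
    by (simp add: covered_bij_betw[OF f] is_array_bij_betw[OF f])
  then show thesis by (rule that)
qed

text \<open>The complement of a down-set is an up-set. As \<open>nrt_le\<close> relates only
  elements of \<open>{1..m * s}\<close>, upward closure stays in the ground set.\<close>

lemma nrt_anti_ideal_iff:
  "nrt_anti_ideal m s J \<longleftrightarrow> J \<subseteq> {1..m * s} \<and> (\<forall>a\<in>J. \<forall>b. nrt_le m s a b \<longrightarrow> b \<in> J)"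
proof
  have range: "nrt_le m s a b \<Longrightarrow> a \<in> {1..m * s} \<and> b \<in> {1..m * s}" for a b
  proof -
    assume "nrt_le m s a b"
    then obtain i where i: "i < m" "a \<in> nrt_block s i" "b \<in> nrt_block s i"
      unfolding nrt_le_def by blast
    have "(i + 1) * s \<le> m * s" using i by (intro mult_le_mono1) simp
    with i show ?thesis by (auto simp: nrt_block_def)
  qed
  show "nrt_anti_ideal m s J \<Longrightarrow>
      J \<subseteq> {1..m * s} \<and> (\<forall>a\<in>J. \<forall>b. nrt_le m s a b \<longrightarrow> b \<in> J)"
    unfolding nrt_anti_ideal_def nrt_ideal_def using range by fastforce
  assume "J \<subseteq> {1..m * s} \<and> (\<forall>a\<in>J. \<forall>b. nrt_le m s a b \<longrightarrow> b \<in> J)"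
  then show "nrt_anti_ideal m s J"
    unfolding nrt_anti_ideal_def nrt_ideal_def
    by (intro exI[of _ "{1..m * s} - J"]) (use range in auto)
qed

lemma OCAN_attained:
  assumes "2 \<le> t" "t \<le> m * s" "0 < v"
  obtains A where "ordered_covering_array (OCAN t m s v) t m s v {..<v} A"
proof -
  obtain N A where "0 < N" "is_array N (m * s) {..<v} A"
      "\<forall>T \<subseteq> {1..m * s}. covered N {..<v} A T"
    using exists_array_of_all_rows[of "{..<v}" "m * s"] assms(3)
    by (metis finite_lessThan lessThan_empty_iff neq0_conv)
  then have "ordered_covering_array N t m s v {..<v} A"
    using assms by (simp add: ordered_covering_array_def nrt_anti_ideal_iff)
  with \<open>0 < N\<close> have "\<exists>N. 0 < N \<and> (\<exists>(V :: nat set) A. ordered_covering_array N t m s v V A)"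
    by blast
  from LeastI_ex[OF this] obtain V :: "nat set" and A
    where A: "ordered_covering_array (OCAN t m s v) t m s v V A" unfolding OCAN_def by blast
  then obtain f where f: "bij_betw f V {..<v}"
    by (metis card_lessThan ordered_covering_array_def finite_lessThan finite_same_card_bij)
  have "ordered_covering_array (OCAN t m s v) t m s v {..<v} (\<lambda>r c. f (A r c))"
    using A unfolding ordered_covering_array_def
    by (simp add: covered_bij_betw[OF f] is_array_bij_betw[OF f])
  then show thesis by (rule that)
qed

lemma covered_pairD:
  assumes "covered N V A {a, b}" "a \<noteq> b" "x \<in> V" "y \<in> V"
  obtains r where "r < N" "A r a = x" "A r b = y"
proof -
  have "\<exists>r<N. \<forall>c\<in>{a, b}. A r c = (if c = a then x else y)"
    using assms(1)[unfolded covered_iff, rule_format, of "\<lambda>c. if c = a then x else y"] assms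
    by auto
  then show thesis using that assms(2) by auto
qed

lemma covered_tripleD:
  assumes "covered N V A {a, b, c}" "a \<noteq> b" "a \<noteq> c" "b \<noteq> c" "x \<in> V" "y \<in> V" "z \<in> V"
  obtains r where "r < N" "A r a = x" "A r b = y" "A r c = z"
proof -
  have "\<exists>r<N. \<forall>d\<in>{a, b, c}. A r d = (if d = a then x else if d = b then y else z)"
    using assms(1)[unfolded covered_iff, rule_format,
        of "\<lambda>d. if d = a then x else if d = b then y else z"] assms
    by auto
  then show thesis using that assms(2-4) by auto
qed

section \<open>Blocks of length two and three\<close>

lemma nrt_le_2:
  "nrt_le m 2 a b \<longleftrightarrow> (\<exists>i<m. (a, b) \<in> {(2*i+1, 2*i+1), (2*i+1, 2*i+2), (2*i+2, 2*i+2)})"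
proof -
  have "(a \<in> nrt_block 2 i \<and> b \<in> nrt_block 2 i \<and> a \<le> b) \<longleftrightarrow>
     (a, b) \<in> {(2*i+1, 2*i+1), (2*i+1, 2*i+2), (2*i+2, 2*i+2)}" for i
    unfolding nrt_block_def atLeastAtMost_iff insert_iff empty_iff prod.inject
    by presburger
  then show ?thesis unfolding nrt_le_def by simp
qed

lemma nrt_le_3:
  "nrt_le m 3 a b \<longleftrightarrow> (\<exists>i<m. (a, b) \<in> {(3*i+1, 3*i+1), (3*i+1, 3*i+2), (3*i+1, 3*i+3),
      (3*i+2, 3*i+2), (3*i+2, 3*i+3), (3*i+3, 3*i+3)})"
proof -
  have "a \<in> nrt_block 3 i \<and> b \<in> nrt_block 3 i \<and> a \<le> b \<longleftrightarrow>
     (a, b) \<in> {(3*i+1, 3*i+1), (3*i+1, 3*i+2), (3*i+1, 3*i+3),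
      (3*i+2, 3*i+2), (3*i+2, 3*i+3), (3*i+3, 3*i+3)}" for i
    unfolding nrt_block_def atLeastAtMost_iff insert_iff empty_iff prod.inject
    by presburger
  then show ?thesis unfolding nrt_le_def by simp
qed

lemma nrt_anti_ideal_2_tops:
  "i < m \<Longrightarrow> j < m \<Longrightarrow> k < m \<Longrightarrow> nrt_anti_ideal m 2 {2*i+2, 2*j+2, 2*k+2}"
  unfolding nrt_anti_ideal_iff nrt_le_2 by auto

lemma nrt_anti_ideal_2_block_top:
  "i < m \<Longrightarrow> j < m \<Longrightarrow> nrt_anti_ideal m 2 {2*i+1, 2*i+2, 2*j+2}"
  unfolding nrt_anti_ideal_iff nrt_le_2 by auto

text \<open>A bot column forces its whole block. Failing that, a mid column forces its top, and the
  third column lies in another block, whose top is then in \<open>J\<close>. Otherwise only tops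
  remain.\<close>

lemma nrt_anti_ideal_3_card_3_cases:
  assumes J: "nrt_anti_ideal m 3 J" and card: "card J = 3"
  obtains (block) i where "i < m" "J = {3*i+1, 3*i+2, 3*i+3}"
  | (mid) i j where "i < m" "j < m" "i \<noteq> j" "J = {3*i+2, 3*i+3, 3*j+3}"
  | (tops) i j k where "i < m" "j < m" "k < m" "i \<noteq> j" "i \<noteq> k" "j \<noteq> k"
      "J = {3*i+3, 3*j+3, 3*k+3}"
proof -
  have fin: "finite J" using card by (simp add: card_ge_0_finite)
  have up: "b \<in> J" if "a \<in> J" "nrt_le m 3 a b" for a b
    using J that unfolding nrt_anti_ideal_iff by blast
  have cols: "\<exists>i<m. c = 3*i+1 \<or> c = 3*i+2 \<or> c = 3*i+3" if "c \<in> J" for c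
  proof -
    have "1 \<le> c" "c \<le> m * 3" using J that unfolding nrt_anti_ideal_iff by auto
    then show ?thesis by presburger
  qed
  have eq: "J = S" if "S \<subseteq> J" "card S = 3" for S
    using card_subset_eq[OF fin that(1)] that(2) card by simp
  show thesis
  proof (cases "\<exists>i<m. 3*i+1 \<in> J")
    case True
    then obtain i where i: "i < m" "3*i+1 \<in> J" by blast
    then have "{3*i+1, 3*i+2, 3*i+3} \<subseteq> J"
      using up[OF i(2), of "3*i+2"] up[OF i(2), of "3*i+3"] by (auto simp: nrt_le_3)
    from eq[OF this] i show thesis by (intro block[of i]) auto
  next
    case nobot: False
    show thesis
    proof (cases "\<exists>i<m. 3*i+2 \<in> J")
      case True
      then obtain i where i: "i < m" "3*i+2 \<in> J" by blast
      then have sub: "{3*i+2, 3*i+3} \<subseteq> J"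
        using up[OF i(2), of "3*i+3"] by (auto simp: nrt_le_3)
      have "{3*i+2, 3*i+3} \<noteq> J" using card by force
      with sub obtain c where c: "c \<in> J" "c \<noteq> 3*i+2" "c \<noteq> 3*i+3" by blast
      then obtain j where j: "j < m" "c = 3*j+2 \<or> c = 3*j+3"
        using cols nobot by blast
      with c have ij: "i \<noteq> j" by auto
      have "3*j+3 \<in> J" using up[OF c(1), of "3*j+3"] j by (auto simp: nrt_le_3)
      then have "{3*i+2, 3*i+3, 3*j+3} \<subseteq> J" using sub by simp
      moreover have "card {3*i+2, 3*i+3, 3*j+3} = 3"
        using ij by (auto simp: card_insert_if)
      ultimately show thesis using eq mid[OF i(1) j(1) ij] by blast
    next
      case False
      with nobot cols have tops': "\<exists>i<m. c = 3*i+3" if "c \<in> J" for c using that by blast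
      obtain a b c where abc: "J = {a, b, c}" "a \<noteq> b" "a \<noteq> c" "b \<noteq> c"
        using card by (auto simp: card_3_iff)
      obtain i j k where ijk: "i < m" "j < m" "k < m" "a = 3*i+3" "b = 3*j+3" "c = 3*k+3"
        using tops'[of a] tops'[of b] tops'[of c] abc(1) by auto
      have "i \<noteq> j" "i \<noteq> k" "j \<noteq> k" using abc(2-4) ijk(4-6) by auto
      from tops[OF ijk(1-3) this] show thesis using abc(1) ijk(4-6) by simp
    qed
  qed
qed

text \<open>Replaces numbered rows and columns by a finite set of row labels with one function per
  level of a block; each shape of anti-ideal gives one coverage condition.\<close>

lemma OCAN_3_le_card:
  fixes V :: "nat set"
  assumes R: "finite R" "R \<noteq> {}" and V: "finite V" "card V = v" and m: "1 \<le> m"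
    and ran: "\<And>r i. r \<in> R \<Longrightarrow> i < m \<Longrightarrow> lo r i \<in> V \<and> mi r i \<in> V \<and> hi r i \<in> V"
    and covers_block: "\<And>i x y z. i < m \<Longrightarrow> x \<in> V \<Longrightarrow> y \<in> V \<Longrightarrow> z \<in> V \<Longrightarrow>
      \<exists>r\<in>R. lo r i = x \<and> mi r i = y \<and> hi r i = z"
    and covers_mid: "\<And>i j x y z. i < m \<Longrightarrow> j < m \<Longrightarrow> i \<noteq> j \<Longrightarrow> x \<in> V \<Longrightarrow> y \<in> V \<Longrightarrow> z \<in> V \<Longrightarrow>
      \<exists>r\<in>R. mi r i = x \<and> hi r i = y \<and> hi r j = z"
    and covers_tops: "\<And>i j k x y z. i < m \<Longrightarrow> j < m \<Longrightarrow> k < m \<Longrightarrow> i \<noteq> j \<Longrightarrow> i \<noteq> k \<Longrightarrow> j \<noteq> k \<Longrightarrow>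
      x \<in> V \<Longrightarrow> y \<in> V \<Longrightarrow> z \<in> V \<Longrightarrow> \<exists>r\<in>R. hi r i = x \<and> hi r j = y \<and> hi r k = z"
  shows "OCAN 3 m 3 v \<le> card R"
proof -
  obtain e where e: "bij_betw e {0..<card R} R"
    using ex_bij_betw_nat_finite[OF R(1)] by blast
  have e_in: "e n \<in> R" if "n < card R" for n using bij_betwE[OF e] that by simp
  have e_surj: "\<exists>n<card R. e n = r" if "r \<in> R" for r
  proof -
    have "r \<in> e ` {0..<card R}" using that by (simp only: bij_betw_imp_surj_on[OF e])
    then show ?thesis by auto
  qed
  \<comment> \<open>Blocks count from 0 but columns from 1, hence \<open>c - 1\<close> before
    splitting into block and level.\<close>
  define A where "A = (\<lambda>n c. let i = (c - 1) div 3 in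
    if (c - 1) mod 3 = 0 then lo (e n) i else
    if (c - 1) mod 3 = 1 then mi (e n) i else hi (e n) i)"
  have A: "A n (3*i+1) = lo (e n) i" "A n (3*i+2) = mi (e n) i" "A n (3*i+3) = hi (e n) i"
    for n i
  proof -
    have "(3*i+2 - 1) mod 3 = 1" "(3*i+2 - 1) div 3 = i"
      "(3*i+3 - 1) mod 3 = 2" "(3*i+3 - 1) div 3 = i" by simp_all presburger
    then show "A n (3*i+1) = lo (e n) i" "A n (3*i+2) = mi (e n) i" "A n (3*i+3) = hi (e n) i"
      unfolding A_def Let_def by simp_all
  qed
  have "is_array (card R) (m * 3) V A"
    unfolding is_array_def
  proof (intro allI impI ballI)
    fix n c assume n: "n < card R" and c: "c \<in> {1..m * 3}"
    then have "(c - 1) div 3 < m" by auto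
    then show "A n c \<in> V" using ran[OF e_in[OF n]] by (auto simp: A_def Let_def)
  qed
  moreover have "covered (card R) V A J" if "nrt_anti_ideal m 3 J" "card J = 3" for J
    unfolding covered_iff
  proof (intro allI impI)
    fix x assume x: "\<forall>c\<in>J. x c \<in> V"
    \<comment> \<open>Speaking of every index \<open>n\<close> of \<open>r\<close> postpones the
      choice of the index to \<open>e_surj\<close>.\<close>
    from that have "\<exists>r\<in>R. \<forall>n. e n = r \<longrightarrow> (\<forall>c\<in>J. A n c = x c)"
    proof (cases rule: nrt_anti_ideal_3_card_3_cases)
      case (block i)
      with x covers_block[of i "x (3*i+1)" "x (3*i+2)" "x (3*i+3)"] show ?thesis
        by (auto simp: A simp del: One_nat_def add_Suc_right add_2_eq_Suc')
    next
      case (mid i j)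
      with x covers_mid[of i j "x (3*i+2)" "x (3*i+3)" "x (3*j+3)"] show ?thesis
        by (auto simp: A simp del: One_nat_def add_Suc_right add_2_eq_Suc')
    next
      case (tops i j k)
      with x covers_tops[of i j k "x (3*i+3)" "x (3*j+3)" "x (3*k+3)"] show ?thesis
        by (auto simp: A simp del: One_nat_def add_Suc_right add_2_eq_Suc')
    qed
    then show "\<exists>n<card R. \<forall>c\<in>J. A n c = x c" using e_surj by metis
  qed
  ultimately have "ordered_covering_array (card R) 3 m 3 v V A"
    using V m by (simp add: ordered_covering_array_def)
  moreover have "0 < card R" using R by (simp add: card_gt_0_iff)
  ultimately show ?thesis unfolding OCAN_def by (intro Least_le) blast
qed

section \<open>The construction\<close>

text \<open>With \<open>w\<close> read as \<infinity>, the cases record which entries are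
  \<infinity>; this pattern decides which family of rows covers the triple.\<close>

lemma atMost_cases3:
  fixes w x y z :: nat
  assumes "x \<in> {..w}" "y \<in> {..w}" "z \<in> {..w}"
  obtains "x < w" "y < w" "z < w" | "x = w" "y < w" "z < w"
    | "x < w" "y = w" "z < w" | "x = w" "y = w" "z < w"
    | "x < w" "y < w" "z = w" | "x = w" "y < w" "z = w"
    | "x < w" "y = w" "z = w" | "x = w" "y = w" "z = w"
  using assms unfolding atMost_iff le_less by blast

text \<open>One constructor per family, in the order of the overview. \<open>Hole k r\<close> has
  \<infinity> in the top of \<open>k\<close>; \<open>Cross k x a\<close> has \<open>a\<close> there
  and \<open>x\<close> in all mids.\<close>

datatype row = Base nat | Hole nat nat | Upper nat | Cross nat nat nat | Infty

locale stacked_arrays =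
  fixes m w N1 N2 N3 :: nat and B H U :: "nat \<Rightarrow> nat \<Rightarrow> nat"
  assumes m: "3 \<le> m"
    and B: "ordered_covering_array N1 3 m 2 w {..<w} B"
    and H: "covering_array N2 2 (m - 1) w {..<w} H"
    and U: "covering_array N3 2 m w {..<w} U"
begin

definition rows :: "row set" where
  "rows = Base ` {..<N1} \<union> (\<lambda>(k, r). Hole k r) ` ({..<m} \<times> {..<N2}) \<union> Upper ` {..<N3} \<union>
     (\<lambda>(k, x, a). Cross k x a) ` ({..<m} \<times> {..<w} \<times> {..<w}) \<union> {Infty}"

text \<open>Numbers the columns other than that of block \<open>k\<close> by \<open>1, \<dots>, m - 1\<close>.\<close>

definition skip :: "nat \<Rightarrow> nat \<Rightarrow> nat" where
  "skip k i = (if i < k then i + 1 else i)"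

text \<open>Outside the \<open>Hole\<close> rows, the bot entry of block \<open>i\<close> will copy
  the top entry of block \<open>other i\<close>.\<close>

definition other :: "nat \<Rightarrow> nat" where
  "other i = (if i = 0 then 1 else 0)"

fun top_col :: "row \<Rightarrow> nat \<Rightarrow> nat" where
  "top_col (Base r) i = B r (2*i+2)"
| "top_col (Hole k r) i = (if i = k then w else H r (skip k i))"
| "top_col (Upper r) i = U r (i+1)"
| "top_col (Cross k x a) i = (if i = k then a else w)"
| "top_col Infty i = w"

fun mid_col :: "row \<Rightarrow> nat \<Rightarrow> nat" where
  "mid_col (Base r) i = B r (2*i+1)"
| "mid_col (Hole k r) i = w"
| "mid_col (Upper r) i = w"
| "mid_col (Cross k x a) i = x"
| "mid_col Infty i = w"

text \<open>For each (mid, top) pair in block \<open>i\<close>, one of the first four families of rows runs through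
  all small symbols while the pair is kept fixed, and a row of another family, or another block,
  provides \<open>\<infinity>\<close>.\<close>

fun bot_col :: "row \<Rightarrow> nat \<Rightarrow> nat" where
  "bot_col (Base r) i = B r (2 * other i + 2)"
| "bot_col (Hole k r) i = (if i = k then H r 1 else w)"
| "bot_col (Upper r) i = U r (other i + 1)"
| "bot_col (Cross k x a) i = (if k = other i then a else w)"
| "bot_col Infty i = w"

section \<open>Number of rows and arithmetic of block indices\<close>

lemma in_rows [simp]:
  "Base r \<in> rows \<longleftrightarrow> r < N1"
  "Hole k r \<in> rows \<longleftrightarrow> k < m \<and> r < N2"
  "Upper r \<in> rows \<longleftrightarrow> r < N3"
  "Cross k x a \<in> rows \<longleftrightarrow> k < m \<and> x < w \<and> a < w"
  "Infty \<in> rows"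
  by (simp_all add: rows_def image_iff Bex_def)

lemma finite_rows: "finite rows"
  by (simp add: rows_def)

text \<open>Each family is the image of its parameter range, so image and union bounds add
  up.\<close>

lemma card_rows_le: "card rows \<le> N1 + m * N2 + N3 + m * w\<^sup>2 + 1"
proof -
  have "card (Base ` {..<N1}) \<le> N1" "card (Upper ` {..<N3}) \<le> N3"
    using card_image_le[of "{..<N1}" Base] card_image_le[of "{..<N3}" Upper] by simp_all
  moreover have "card ((\<lambda>(k, r). Hole k r) ` ({..<m} \<times> {..<N2})) \<le> m * N2"
    by (rule order_trans[OF card_image_le]) simp_all
  moreover have "card ((\<lambda>(k, x, a). Cross k x a) ` ({..<m} \<times> {..<w} \<times> {..<w})) \<le> m * w\<^sup>2"
    by (rule order_trans[OF card_image_le]) (simp_all add: power2_eq_square)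
  moreover have "card {Infty} \<le> 1" by simp
  ultimately show ?thesis
    unfolding rows_def by (intro order_trans[OF card_Un_le] add_mono)
qed

lemma other: "i < m \<Longrightarrow> other i < m" "other i \<noteq> i" "i \<noteq> other i"
  using m by (auto simp: other_def)

lemma skip: "k < m \<Longrightarrow> i < m \<Longrightarrow> i \<noteq> k \<Longrightarrow> skip k i \<in> {1..m - 1}"
  by (auto simp: skip_def)

lemma skip_inj: "i \<noteq> k \<Longrightarrow> j \<noteq> k \<Longrightarrow> i \<noteq> j \<Longrightarrow> skip k i \<noteq> skip k j"
  by (auto simp: skip_def)

lemma third_block:
  obtains k where "k < m" "k \<noteq> i" "k \<noteq> j"
proof -
  have "\<exists>k\<in>{0, 1, 2 :: nat}. k \<noteq> i \<and> k \<noteq> j" by auto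
  then obtain k where "k \<in> {0, 1, 2}" "k \<noteq> i" "k \<noteq> j" by blast
  then show thesis using that[of k] m by auto
qed

section \<open>Entries and coverage supplied by the ingredient arrays\<close>

lemma B_lt: "r < N1 \<Longrightarrow> i < m \<Longrightarrow> B r (2*i+1) < w \<and> B r (2*i+2) < w"
  using B unfolding ordered_covering_array_def is_array_def by auto

lemma H_lt: "r < N2 \<Longrightarrow> c \<in> {1..m - 1} \<Longrightarrow> H r c < w"
  using H unfolding covering_array_def is_array_def by auto

lemma U_lt: "r < N3 \<Longrightarrow> i < m \<Longrightarrow> U r (i+1) < w"
  using U unfolding covering_array_def is_array_def by auto

lemma B_tops:
  assumes "i < m" "j < m" "k < m" "i \<noteq> j" "i \<noteq> k" "j \<noteq> k" "x < w" "y < w" "z < w"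
  obtains r where "r < N1" "B r (2*i+2) = x" "B r (2*j+2) = y" "B r (2*k+2) = z"
proof -
  have "covered N1 {..<w} B {2*i+2, 2*j+2, 2*k+2}"
    using B nrt_anti_ideal_2_tops[of i m j k] assms
    unfolding ordered_covering_array_def by (simp add: card_insert_if)
  then show thesis by (rule covered_tripleD[where x = x and y = y and z = z]) (use assms that in auto)
qed

lemma B_block_top:
  assumes "i < m" "j < m" "i \<noteq> j" "x < w" "y < w" "z < w"
  obtains r where "r < N1" "B r (2*i+1) = x" "B r (2*i+2) = y" "B r (2*j+2) = z"
proof -
  \<comment> \<open>Parity separates the mid column of one block from the top of another, so the set
    has three elements.\<close>
  have "2*i+1 \<noteq> 2*j+2" by presburger
  then have "covered N1 {..<w} B {2*i+1, 2*i+2, 2*j+2}"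
    using B nrt_anti_ideal_2_block_top[of i m j] assms
    unfolding ordered_covering_array_def by (simp add: card_insert_if)
  then show thesis
    by (rule covered_tripleD[where x = x and y = y and z = z])
      (use assms that \<open>2*i+1 \<noteq> 2*j+2\<close> in auto)
qed

lemma H_pair:
  assumes "c \<in> {1..m - 1}" "d \<in> {1..m - 1}" "c \<noteq> d" "x < w" "y < w"
  obtains r where "r < N2" "H r c = x" "H r d = y"
proof -
  have "covered N2 {..<w} H {c, d}"
    using H assms unfolding covering_array_def by (simp add: card_insert_if)
  then show thesis by (rule covered_pairD[where x = x and y = y]) (use assms that in auto)
qed

text \<open>Strength 2 covers a single column through any second column \<open>d\<close>;
  \<open>m - 1 \<ge> 2\<close> leaves room for one.\<close>

lemma H_single:
  assumes "c \<in> {1..m - 1}" "x < w"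
  obtains r where "r < N2" "H r c = x"
proof -
  define d where "d = (if c = 1 then 2 else 1 :: nat)"
  have "d \<in> {1..m - 1}" "d \<noteq> c" using m by (auto simp: d_def)
  then show thesis using H_pair[of c d x x] assms that by metis
qed

lemma U_pair:
  assumes "i < m" "j < m" "i \<noteq> j" "x < w" "y < w"
  obtains r where "r < N3" "U r (i+1) = x" "U r (j+1) = y"
proof -
  have "covered N3 {..<w} U {i+1, j+1}"
    using U assms unfolding covering_array_def by (simp add: card_insert_if)
  then show thesis by (rule covered_pairD[where x = x and y = y]) (use assms that in auto)
qed

section \<open>Range and coverage of the stacked array\<close>

lemma entries_le:
  assumes "\<rho> \<in> rows" "i < m"
  shows "bot_col \<rho> i \<in> {..w} \<and> mid_col \<rho> i \<in> {..w} \<and> top_col \<rho> i \<in> {..w}"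
proof (cases \<rho>)
  case (Base r)
  then show ?thesis using assms B_lt[of r i] B_lt[of r "other i"] other by auto
next
  case (Hole k r)
  then show ?thesis using assms m H_lt[of r 1] H_lt[OF _ skip[of k i]] by (auto simp: less_imp_le)
next
  case (Upper r)
  then show ?thesis using assms U_lt[of r i] U_lt[of r "other i"] other by auto
qed (use assms in auto)

text \<open>For each (mid, top) pair, one family supplies the small bot symbols and another row
  supplies \<infinity>. Both small: \<open>Base\<close>, then \<open>Cross i\<close>. Only mid
  \<infinity>: \<open>Upper\<close>, then \<open>Hole k\<close>. Only top \<infinity>:
  \<open>Cross (other i)\<close>, then \<open>Cross k\<close>. Both \<infinity>:
  \<open>Hole i\<close>, then \<open>Infty\<close>.\<close>

lemma block_covered:
  assumes i: "i < m" and "x \<in> {..w}" "y \<in> {..w}" "z \<in> {..w}"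
  shows "\<exists>\<rho>\<in>rows. bot_col \<rho> i = x \<and> mid_col \<rho> i = y \<and> top_col \<rho> i = z"
proof -
  note o = other(1)[OF i] other(2,3)[of i]
  obtain k where k: "k < m" "k \<noteq> i" "k \<noteq> other i" by (rule third_block)
  from assms(2-4) show ?thesis
  proof (cases rule: atMost_cases3)
    case 1
    then obtain r where "r < N1" "B r (2*i+1) = y" "B r (2*i+2) = z" "B r (2 * other i + 2) = x"
      using B_block_top[OF i o(1) o(3)] by metis
    then show ?thesis by (intro bexI[of _ "Base r"]) auto
  next
    case 2
    then show ?thesis using i o by (intro bexI[of _ "Cross i y z"]) auto
  next
    case 3
    then obtain r where "r < N3" "U r (i+1) = z" "U r (other i + 1) = x"
      using U_pair[OF i o(1) o(3)] by metis
    with 3 show ?thesis by (intro bexI[of _ "Upper r"]) auto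
  next
    case 4
    then obtain r where "r < N2" "H r (skip k i) = z"
      using H_single[OF skip[OF k(1) i]] k by metis
    with 4 k show ?thesis by (intro bexI[of _ "Hole k r"]) auto
  next
    case 5
    then show ?thesis using o by (intro bexI[of _ "Cross (other i) y x"]) auto
  next
    case 6
    \<comment> \<open>Since \<open>k\<close> is neither \<open>i\<close> nor \<open>other i\<close>,
      both top and bot are \<infinity>; \<open>0\<close> is a small symbol because
      \<open>y < w\<close>.\<close>
    then show ?thesis using k by (intro bexI[of _ "Cross k y 0"]) auto
  next
    case 7
    \<comment> \<open>Column 1 of \<open>H\<close> is the one placed in the bot of the block whose
      top is \<infinity>.\<close>
    have "1 \<in> {1..m - 1}" using m by simp
    then obtain r where "r < N2" "H r 1 = x"
      using H_single 7(1) by metis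
    with 7 i show ?thesis by (intro bexI[of _ "Hole i r"]) auto
  next
    case 8
    then show ?thesis by (intro bexI[of _ Infty]) auto
  qed
qed

text \<open>A small mid is served by \<open>Base\<close> if both tops are small, and otherwise by
  \<open>Cross\<close> at the block of the small top, or at a third block if neither is small. Mid
  \<infinity> is served by \<open>Upper\<close>, \<open>Hole\<close> or \<open>Infty\<close>, for
  zero, one or two tops equal to \<infinity>.\<close>

lemma mid_covered:
  assumes i: "i < m" and j: "j < m" and ij: "i \<noteq> j"
    and "x \<in> {..w}" "y \<in> {..w}" "z \<in> {..w}"
  shows "\<exists>\<rho>\<in>rows. mid_col \<rho> i = x \<and> top_col \<rho> i = y \<and> top_col \<rho> j = z"
proof -
  obtain k where k: "k < m" "k \<noteq> i" "k \<noteq> j" by (rule third_block)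
  from assms(4-6) show ?thesis
  proof (cases rule: atMost_cases3)
    case 1
    then obtain r where "r < N1" "B r (2*i+1) = x" "B r (2*i+2) = y" "B r (2*j+2) = z"
      using B_block_top[OF i j ij] by metis
    then show ?thesis by (intro bexI[of _ "Base r"]) auto
  next
    case 2
    then obtain r where "r < N3" "U r (i+1) = y" "U r (j+1) = z"
      using U_pair[OF i j ij] by metis
    with 2 show ?thesis by (intro bexI[of _ "Upper r"]) auto
  next
    case 3
    then show ?thesis using j ij by (intro bexI[of _ "Cross j x z"]) auto
  next
    case 4
    then obtain r where "r < N2" "H r (skip i j) = z"
      using H_single[OF skip[OF i j]] ij by metis
    with 4 i ij show ?thesis by (intro bexI[of _ "Hole i r"]) auto
  next
    case 5
    then show ?thesis using i ij by (intro bexI[of _ "Cross i x y"]) auto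
  next
    case 6
    then obtain r where "r < N2" "H r (skip j i) = y"
      using H_single[OF skip[OF j i]] ij by metis
    with 6 j ij show ?thesis by (intro bexI[of _ "Hole j r"]) auto
  next
    case 7
    then show ?thesis using k by (intro bexI[of _ "Cross k x 0"]) auto
  next
    case 8
    then show ?thesis by (intro bexI[of _ Infty]) auto
  qed
qed

text \<open>Isolates the triples of tops with exactly one \<infinity>, to be used with \<infinity>
  in each of the three positions.\<close>

lemma hole_covered:
  assumes "k < m" "i < m" "j < m" "i \<noteq> k" "j \<noteq> k" "i \<noteq> j" "x < w" "y < w"
  shows "\<exists>\<rho>\<in>rows. top_col \<rho> k = w \<and> top_col \<rho> i = x \<and> top_col \<rho> j = y"
proof -
  obtain r where "r < N2" "H r (skip k i) = x" "H r (skip k j) = y"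
    using H_pair[of "skip k i" "skip k j" x y] skip[of k] skip_inj[of i k j] assms by metis
  with assms show ?thesis by (intro bexI[of _ "Hole k r"]) auto
qed

text \<open>The number of entries \<infinity> selects the family: \<open>Base\<close> for none,
  \<open>Hole\<close> for one, \<open>Cross\<close> for two, \<open>Infty\<close> for three.\<close>

lemma tops_covered:
  assumes "i < m" "j < m" "k < m" "i \<noteq> j" "i \<noteq> k" "j \<noteq> k"
    and "x \<in> {..w}" "y \<in> {..w}" "z \<in> {..w}"
  shows "\<exists>\<rho>\<in>rows. top_col \<rho> i = x \<and> top_col \<rho> j = y \<and> top_col \<rho> k = z"
proof -
  from assms(7-9) show ?thesis
  proof (cases rule: atMost_cases3)
    case 1
    then obtain r where "r < N1" "B r (2*i+2) = x" "B r (2*j+2) = y" "B r (2*k+2) = z"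
      using B_tops[OF assms(1-6)] by metis
    then show ?thesis by (intro bexI[of _ "Base r"]) auto
  next
    case 2
    then show ?thesis using hole_covered[of i j k y z] assms(1-6) by blast
  next
    case 3
    then show ?thesis using hole_covered[of j i k x z] assms(1-6) by blast
  next
    case 4
    \<comment> \<open>The mid symbol of the \<open>Cross\<close> row is free; \<open>z\<close> is
      reused since it is known to be small.\<close>
    then show ?thesis using assms(1-6) by (intro bexI[of _ "Cross k z z"]) auto
  next
    case 5
    then show ?thesis using hole_covered[of k i j x y] assms(1-6) by blast
  next
    case 6
    then show ?thesis using assms(1-6) by (intro bexI[of _ "Cross j y y"]) auto
  next
    case 7
    then show ?thesis using assms(1-6) by (intro bexI[of _ "Cross i x x"]) auto
  next
    case 8
    then show ?thesis by (intro bexI[of _ Infty]) auto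
  qed
qed

lemma OCAN_le: "OCAN 3 m 3 (w + 1) \<le> N1 + m * N2 + N3 + m * w\<^sup>2 + 1"
proof -
  have "OCAN 3 m 3 (w + 1) \<le> card rows"
  \<comment> \<open>\<open>{..w}\<close> is the small alphabet with \<infinity> adjoined, so it has
    \<open>w + 1\<close> symbols.\<close>
  proof (rule OCAN_3_le_card[where V = "{..w}" and lo = bot_col and mi = mid_col and hi = top_col])
    show "rows \<noteq> {}" using in_rows(5) by blast
    show "1 \<le> m" using m by simp
  qed (use finite_rows entries_le block_covered mid_covered tops_covered in simp_all)
  then show ?thesis using card_rows_le by (rule order_trans)
qed

end

section \<open>Instantiation with optimal ingredient arrays\<close>

theorem theorem4:
  fixes m v :: nat
  assumes "m \<ge> 3" and "v \<ge> 3"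
  shows "OCAN 3 m 3 v \<le>
    OCAN 3 m 2 (v - 1) + m * CAN 2 (m - 1) (v - 1) + CAN 2 m (v - 1) + m * (v - 1)^2 + 1"
proof -
  \<comment> \<open>\<open>m \<ge> 3\<close> keeps each strength within the number of columns, and
    \<open>v \<ge> 3\<close> makes the alphabet \<open>{..<v - 1}\<close> nonempty.\<close>
  obtain B where B: "ordered_covering_array (OCAN 3 m 2 (v - 1)) 3 m 2 (v - 1) {..<v - 1} B"
    by (rule OCAN_attained[of 3 m 2 "v - 1"]) (use assms in auto)
  obtain H where H: "covering_array (CAN 2 (m - 1) (v - 1)) 2 (m - 1) (v - 1) {..<v - 1} H"
    by (rule CAN_attained[of 2 "m - 1" "v - 1"]) (use assms in auto)
  obtain U where U: "covering_array (CAN 2 m (v - 1)) 2 m (v - 1) {..<v - 1} U"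
    by (rule CAN_attained[of 2 m "v - 1"]) (use assms in auto)
  interpret stacked_arrays m "v - 1" "OCAN 3 m 2 (v - 1)" "CAN 2 (m - 1) (v - 1)"
    "CAN 2 m (v - 1)" B H U
    using assms B H U by unfold_locales auto
  show ?thesis using OCAN_le assms by simp
qed

end
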